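(* There exist two conformal isometric minimal surfaces in $\mathbb{H}^2\times\mathbb{R}$ with constant Gaussian curvature $-1$ that are non associate. That is, there exist a simply connected domain $\Omega\subset\mathbb{C}$ and two conformal minimal immersions $X=(h,f),\ Y=(h^*,f^* ):\Omega\to\mathbb{H}^2\times\mathbb{R}$ which induce the same metric on $\Omega$, this metric having constant Gaussian curvature $-1$, such that $X$ and $Y$ are not associate.
   Context: $\mathbb{H}^2$ is the unit disc with metric $\sigma^2(z)|dz|^2$, $\sigma(z)=2/(1-|z|^2)$, and $\mathbb{H}^2\times\mathbb{R}$ carries the product metric. Let $w=u+iv$ be the coordinate on $\Omega$. If $X=(h,f)$ is a conformal minimal immersion then $h$ is harmonic, and its Hopf (holomorphic) quadratic differential is $Q(h)=(\sigma\circ h)^2\,h_w\,\overline{h}_w\,(dw)^2$, where $\overline{h}_w=\partial_w(\overline h)=\overline{h_{\bar w}}$. Two conformal minimal immersions $X=(h,f)$ and $X^*=(h^*,f^* )$ of $\Omega$ are associate if they are isometric (they induce the same metric on $\Omega$) and $Q(h^* )=e^{2i\theta}Q(h)$ for some real number $\theta$. *)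

theory Defs
  imports "HOL-Analysis.Analysis"
begin

text \<open>
  Riemannian metrics on open subsets of a Euclidean space are given in the global chart:
  \<open>g p v w\<close> is the inner product of the tangent vectors \<open>v\<close>, \<open>w\<close> at \<open>p\<close>.  All derivatives are
  real (Frechet) derivatives, also for maps defined on \<^typ>\<open>complex\<close>; the coordinate fields
  \<open>\<partial>/\<partial>u\<close>, \<open>\<partial>/\<partial>v\<close> of \<open>w = u + i v\<close> are the vectors \<open>1\<close> and \<open>\<i>\<close>.
\<close>

type_synonym 'a metric = "'a \<Rightarrow> 'a \<Rightarrow> 'a \<Rightarrow> real"

definition dir_deriv :: "('a::real_normed_vector \<Rightarrow> 'b::real_normed_vector) \<Rightarrow> 'a \<Rightarrow> 'a \<Rightarrow> 'b" where
  "dir_deriv F p v = frechet_derivative F (at p) v"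

fun Ck_on :: "nat \<Rightarrow> 'a::real_normed_vector set \<Rightarrow> ('a \<Rightarrow> 'b::real_normed_vector) \<Rightarrow> bool" where
  "Ck_on 0 S F \<longleftrightarrow> continuous_on S F"
| "Ck_on (Suc k) S F \<longleftrightarrow>
     (\<forall>p\<in>S. F differentiable (at p)) \<and> (\<forall>v. Ck_on k S (\<lambda>p. dir_deriv F p v))"

definition smooth_on :: "'a::real_normed_vector set \<Rightarrow> ('a \<Rightarrow> 'b::real_normed_vector) \<Rightarrow> bool" where
  "smooth_on S F \<longleftrightarrow> (\<forall>k. Ck_on k S F)"

text \<open>
  Levi-Civita connection: the Koszul formula for constant (hence commuting) vector fields
  determines \<open>\<nabla>\<^sub>u v = christoffel g p u v\<close>.
\<close>

definition christoffel_first ::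
  "'a::real_normed_vector metric \<Rightarrow> 'a \<Rightarrow> 'a \<Rightarrow> 'a \<Rightarrow> 'a \<Rightarrow> real" where
  "christoffel_first g p u v w =
     (dir_deriv (\<lambda>q. g q v w) p u + dir_deriv (\<lambda>q. g q u w) p v
      - dir_deriv (\<lambda>q. g q u v) p w) / 2"

definition christoffel :: "'a::real_normed_vector metric \<Rightarrow> 'a \<Rightarrow> 'a \<Rightarrow> 'a \<Rightarrow> 'a" where
  "christoffel g p u v = (THE c. \<forall>w. g p c w = christoffel_first g p u v w)"

text \<open>Sign convention: \<open>R(u,v)w = \<nabla>\<^sub>u \<nabla>\<^sub>v w - \<nabla>\<^sub>v \<nabla>\<^sub>u w\<close> for constant fields.\<close>

definition riemann :: "'a::real_normed_vector metric \<Rightarrow> 'a \<Rightarrow> 'a \<Rightarrow> 'a \<Rightarrow> 'a \<Rightarrow> 'a" where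
  "riemann g p u v w =
     dir_deriv (\<lambda>q. christoffel g q v w) p u - dir_deriv (\<lambda>q. christoffel g q u w) p v
     + christoffel g p u (christoffel g p v w) - christoffel g p v (christoffel g p u w)"

definition gauss_curvature :: "complex metric \<Rightarrow> complex \<Rightarrow> real" where
  "gauss_curvature g p =
     g p (riemann g p 1 \<i> \<i>) 1 / (g p 1 1 * g p \<i> \<i> - (g p 1 \<i>)\<^sup>2)"

definition sigma :: "complex \<Rightarrow> real" where
  "sigma z = 2 / (1 - (norm z)\<^sup>2)"

definition H2_metric :: "complex metric" where
  "H2_metric z v w = (sigma z)\<^sup>2 * (v \<bullet> w)"

definition H2R :: "(complex \<times> real) set" where
  "H2R = ball 0 1 \<times> UNIV"

definition H2R_metric :: "(complex \<times> real) metric" where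
  "H2R_metric p v w = H2_metric (fst p) (fst v) (fst w) + snd v * snd w"

definition induced_metric :: "(complex \<Rightarrow> complex \<times> real) \<Rightarrow> complex metric" where
  "induced_metric X w a b = H2R_metric (X w) (dir_deriv X w a) (dir_deriv X w b)"

definition immersion_on :: "complex set \<Rightarrow> (complex \<Rightarrow> complex \<times> real) \<Rightarrow> bool" where
  "immersion_on \<Omega> X \<longleftrightarrow>
     smooth_on \<Omega> X \<and> X ` \<Omega> \<subseteq> H2R \<and> (\<forall>w\<in>\<Omega>. inj (dir_deriv X w))"

definition conformal_on :: "complex set \<Rightarrow> (complex \<Rightarrow> complex \<times> real) \<Rightarrow> bool" where
  "conformal_on \<Omega> X \<longleftrightarrow>
     (\<forall>w\<in>\<Omega>. \<exists>\<mu>>0. \<forall>a b. induced_metric X w a b = \<mu> * (a \<bullet> b))"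

text \<open>
  Covariant derivative along \<open>X\<close>, in the direction \<open>a\<close>, of the field \<open>dX(b)\<close>, for constant
  \<open>a\<close> and \<open>b\<close>.
\<close>

definition cov_deriv ::
  "(complex \<Rightarrow> complex \<times> real) \<Rightarrow> complex \<Rightarrow> complex \<Rightarrow> complex \<Rightarrow> complex \<times> real" where
  "cov_deriv X w a b =
     dir_deriv (\<lambda>q. dir_deriv X q b) w a
     + christoffel H2R_metric (X w) (dir_deriv X w a) (dir_deriv X w b)"

definition unit_normal :: "(complex \<Rightarrow> complex \<times> real) \<Rightarrow> complex \<Rightarrow> complex \<times> real \<Rightarrow> bool" where
  "unit_normal X w n \<longleftrightarrow>
     H2R_metric (X w) n n = 1 \<and> (\<forall>a. H2R_metric (X w) n (dir_deriv X w a) = 0)"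

definition second_fundamental_form ::
  "(complex \<Rightarrow> complex \<times> real) \<Rightarrow> complex \<Rightarrow> complex \<times> real \<Rightarrow> complex \<Rightarrow> complex \<Rightarrow> real" where
  "second_fundamental_form X w n a b = H2R_metric (X w) (cov_deriv X w a b) n"

definition mean_curvature ::
  "(complex \<Rightarrow> complex \<times> real) \<Rightarrow> complex \<Rightarrow> complex \<times> real \<Rightarrow> real" where
  "mean_curvature X w n =
     (let I = induced_metric X w; II = second_fundamental_form X w n
      in (I \<i> \<i> * II 1 1 - 2 * I 1 \<i> * II 1 \<i> + I 1 1 * II \<i> \<i>)
         / (2 * (I 1 1 * I \<i> \<i> - (I 1 \<i>)\<^sup>2)))"

definition minimal_on :: "complex set \<Rightarrow> (complex \<Rightarrow> complex \<times> real) \<Rightarrow> bool" where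
  "minimal_on \<Omega> X \<longleftrightarrow> (\<forall>w\<in>\<Omega>. \<forall>n. unit_normal X w n \<longrightarrow> mean_curvature X w n = 0)"

definition conformal_minimal_immersion ::
  "complex set \<Rightarrow> (complex \<Rightarrow> complex \<times> real) \<Rightarrow> bool" where
  "conformal_minimal_immersion \<Omega> X \<longleftrightarrow>
     immersion_on \<Omega> X \<and> conformal_on \<Omega> X \<and> minimal_on \<Omega> X"

definition isometric_on ::
  "complex set \<Rightarrow> (complex \<Rightarrow> complex \<times> real) \<Rightarrow> (complex \<Rightarrow> complex \<times> real) \<Rightarrow> bool" where
  "isometric_on \<Omega> X Y \<longleftrightarrow>
     (\<forall>w\<in>\<Omega>. \<forall>a b. induced_metric X w a b = induced_metric Y w a b)"

text \<open>The Wirtinger derivative \<open>\<partial>/\<partial>w = (\<partial>/\<partial>u - i \<partial>/\<partial>v) / 2\<close>.\<close>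

definition wirtinger :: "(complex \<Rightarrow> complex) \<Rightarrow> complex \<Rightarrow> complex" where
  "wirtinger h w = (dir_deriv h w 1 - \<i> * dir_deriv h w \<i>) / 2"

text \<open>The coefficient of \<open>(dw)\<^sup>2\<close> in the Hopf differential \<open>Q(h)\<close>.\<close>

definition hopf :: "(complex \<Rightarrow> complex) \<Rightarrow> complex \<Rightarrow> complex" where
  "hopf h w = (complex_of_real (sigma (h w)))\<^sup>2 * wirtinger h w * wirtinger (\<lambda>q. cnj (h q)) w"

definition associate_on ::
  "complex set \<Rightarrow> (complex \<Rightarrow> complex \<times> real) \<Rightarrow> (complex \<Rightarrow> complex \<times> real) \<Rightarrow> bool" where
  "associate_on \<Omega> X Y \<longleftrightarrow>
     isometric_on \<Omega> X Y \<and>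
     (\<exists>\<theta>::real. \<forall>w\<in>\<Omega>. hopf (fst \<circ> Y) w = exp (2 * \<i> * complex_of_real \<theta>) * hopf (fst \<circ> X) w)"

end

theory Submission
  imports Defs
begin

text \<open>
  The simplest minimal surface of curvature \<open>-1\<close> is a horizontal slice; being parametrized by a
  holomorphic map, it has Hopf differential \<open>0\<close>.  Every surface associate to it then also has Hopf
  differential \<open>0\<close>, so it is enough to find a minimal surface with the same metric whose Hopf
  differential does not vanish.

  Such a surface is found by looking at immersions of the strip \<open>\<bar>Re w\<bar> < \<pi>/2\<close> with \<open>Q(h) = 1/4\<close>
  and metric \<open>(cosh \<omega>)\<^sup>2 |dw|\<^sup>2\<close>.  Harmonicity gives \<open>\<Delta>\<omega> = sinh \<omega> cosh \<omega>\<close>, and curvature \<open>-1\<close> then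
  means \<open>|\<nabla>\<omega>| = cosh \<omega>\<close>; both hold for \<open>\<omega>\<close> depending on \<open>u\<close> alone with \<open>sinh \<omega> = tan u\<close>,
  that is \<open>cosh \<omega> = 1 / cos u\<close>.  With \<open>f = v\<close>, the pullback of the metric of the disc by \<open>h\<close> has to
  be \<open>(du\<^sup>2 + (sin u)\<^sup>2 dv\<^sup>2) / (cos u)\<^sup>2\<close>, the hyperbolic metric in polar coordinates with
  \<open>tanh (r/2) = tan (u/2)\<close> and angle \<open>v\<close>.  So \<open>Y(u + iv) = (tan (u/2) e\<^sup>i\<^sup>v, v)\<close>, a helicoid.
  The metric \<open>|dw|\<^sup>2 / (cos u)\<^sup>2\<close> is the hyperbolic metric of the strip, and
  \<open>X(w) = (tan (w/2), 0)\<close>, a conformal bijection of the strip onto the disc, induces it as well.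

  The metrics are computed in \<open>slice_metric\<close> and \<open>helicoid_metric\<close>, their curvature in
  \<open>gauss_curvature_strip\<close>.  Minimality is reduced to harmonicity by \<open>minimal_on_harmonic\<close> and
  follows from \<open>slice_harmonic\<close> and \<open>helicoid_harmonic\<close>; \<open>slice_hopf\<close> and \<open>hopf_helicoid_0\<close>
  separate the two surfaces.
\<close>

section \<open>Directional derivatives and smoothness\<close>

lemma dir_deriv_eq: "(F has_derivative D) (at p) \<Longrightarrow> dir_deriv F p v = D v"
  unfolding dir_deriv_def using frechet_derivative_at by metis

lemma has_derivative_dir_deriv:
  "F differentiable (at p) \<Longrightarrow> (F has_derivative dir_deriv F p) (at p)"
  using frechet_derivative_works[of F "at p"] by (simp add: dir_deriv_def[abs_def])

lemma dir_deriv_eq_on: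
  assumes "open S" "p \<in> S" "\<And>q. q \<in> S \<Longrightarrow> F q = G q" "(G has_derivative D) (at p)"
  shows "dir_deriv F p v = D v"
  using assms by (intro dir_deriv_eq) (metis has_derivative_transform_within_open)

lemma Ck_on_cong:
  assumes "open S" "\<And>p. p \<in> S \<Longrightarrow> F p = G p" "Ck_on k S G"
  shows "Ck_on k S F"
  using assms(2,3)
proof (induction k arbitrary: F G)
  case 0
  then show ?case by (simp cong: continuous_on_cong)
next
  case (Suc k)
  have D: "(F has_derivative dir_deriv G p) (at p)" if "p \<in> S" for p
  proof -
    have "(G has_derivative dir_deriv G p) (at p)"
      using Suc.prems(2) that by (intro has_derivative_dir_deriv) simp
    then show ?thesis
      using has_derivative_transform_within_open[OF _ \<open>open S\<close> that, of G _ UNIV F] Suc.prems(1)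
      by simp
  qed
  show ?case
    unfolding Ck_on.simps
  proof (intro conjI ballI allI)
    show "F differentiable (at p)" if "p \<in> S" for p
      using D[OF that] by (auto simp: differentiable_def)
    show "Ck_on k S (\<lambda>p. dir_deriv F p v)" for v
      by (rule Suc.IH[of _ "\<lambda>p. dir_deriv G p v"])
        (use dir_deriv_eq[OF D] Suc.prems(2) in auto)
  qed
qed

lemma Ck_on_SucI:
  assumes "open S" "\<And>p. p \<in> S \<Longrightarrow> (F has_derivative D p) (at p)"
    and "\<And>v. Ck_on k S (\<lambda>p. D p v)"
  shows "Ck_on (Suc k) S F"
  unfolding Ck_on.simps
proof (intro conjI ballI allI)
  show "F differentiable (at p)" if "p \<in> S" for p
    using assms(2)[OF that] by (auto simp: differentiable_def)
  show "Ck_on k S (\<lambda>p. dir_deriv F p v)" for v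
    by (rule Ck_on_cong[OF assms(1) _ assms(3)[of v]]) (use dir_deriv_eq[OF assms(2)] in auto)
qed

lemma Ck_on_const: "open S \<Longrightarrow> Ck_on k S (\<lambda>_. c)"
  by (induction k arbitrary: c)
    (simp, rule Ck_on_SucI[where D = "\<lambda>_ _. 0"], auto)

lemma Ck_on_linear:
  assumes "open S" "bounded_linear L"
  shows "Ck_on k S L"
proof (cases k)
  case 0
  then show ?thesis using assms by (simp add: linear_continuous_on)
next
  case (Suc m)
  show ?thesis unfolding Suc
    by (rule Ck_on_SucI[where D = "\<lambda>_. L"])
      (use assms Ck_on_const bounded_linear_imp_has_derivative in auto)
qed

lemma Ck_on_linear_compose:
  assumes "open S" "bounded_linear L" "Ck_on k S F"
  shows "Ck_on k S (\<lambda>p. L (F p))"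
  using assms(3)
proof (induction k arbitrary: F)
  case 0
  then show ?case using assms(2) by (simp add: bounded_linear.continuous_on)
next
  case (Suc k)
  show ?case
    by (rule Ck_on_SucI[where D = "\<lambda>p v. L (dir_deriv F p v)", OF assms(1)])
      (use Suc in \<open>auto intro!: bounded_linear.has_derivative[OF assms(2)]
          has_derivative_dir_deriv\<close>)
qed

lemma Ck_on_add:
  assumes "open S" "Ck_on k S F" "Ck_on k S G"
  shows "Ck_on k S (\<lambda>p. F p + G p)"
  using assms(2,3)
proof (induction k arbitrary: F G)
  case 0
  then show ?case by (simp add: continuous_on_add)
next
  case (Suc k)
  show ?case
    by (rule Ck_on_SucI[where D = "\<lambda>p v. dir_deriv F p v + dir_deriv G p v", OF assms(1)])
      (use Suc in \<open>auto intro!: has_derivative_add has_derivative_dir_deriv\<close>)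
qed

text \<open>
  Smoothness is an infinite tower of conditions on iterated derivatives.  It is enough to enclose the
  function in a family in which \<open>d i v\<close> is the index of the derivative of \<open>\<Phi> i\<close> in the direction
  \<open>v\<close>; the induction on the order then runs over all members at once.  The families used below are
  indexed by complex polynomials.
\<close>

lemma Ck_on_closed_family:
  assumes "open S"
    and "\<And>i p. p \<in> S \<Longrightarrow> (\<Phi> i has_derivative (\<lambda>v. \<Phi> (d i v) p)) (at p)"
  shows "Ck_on k S (\<Phi> i)"
proof (induction k arbitrary: i)
  case 0
  have "continuous (at p) (\<Phi> i)" if "p \<in> S" for p
    using assms(2)[OF that] by (rule has_derivative_continuous)
  then show ?case by (simp add: continuous_at_imp_continuous_on)
next
  case (Suc k)
  show ?case
    by (rule Ck_on_SucI[OF assms]) (auto simp: Suc)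
qed

section \<open>Conformal metrics, harmonic maps and minimality\<close>

text \<open>
  The second assumption is nondegeneracy of the metric at \<open>p\<close>; without it the definite description
  that defines the connection would be unspecified.
\<close>

lemma christoffel_eqI:
  assumes "\<And>w. g p c w = christoffel_first g p u v w"
    and "\<And>c'. (\<And>w. g p c' w = g p c w) \<Longrightarrow> c' = c"
  shows "christoffel g p u v = c"
  unfolding christoffel_def by (rule the_equality) (use assms in auto)

lemma sigma_pos: "norm z < 1 \<Longrightarrow> sigma z > 0"
  by (simp add: sigma_def abs_square_less_1)

lemma has_derivative_sigma_squared:
  assumes "norm z < 1"
  shows "((\<lambda>z. (sigma z)\<^sup>2) has_derivative (\<lambda>u. 2 * (sigma z) ^ 3 * (z \<bullet> u))) (at z)"
proof -
  have nz: "1 - (norm z)\<^sup>2 \<noteq> 0"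
    using assms sigma_pos by (fastforce simp: sigma_def)
  have "((\<lambda>z::complex. (2 / (1 - z \<bullet> z))\<^sup>2) has_derivative
     (\<lambda>u. 2 * (2 / (1 - z \<bullet> z)) ^ 3 * (z \<bullet> u))) (at z)"
    using nz unfolding power2_norm_eq_inner
    by (auto intro!: derivative_eq_intros
        simp: inner_commute power2_eq_square power3_eq_cube fun_eq_iff)
  then show ?thesis
    by (simp add: sigma_def[abs_def] power2_norm_eq_inner)
qed

text \<open>
  For a conformal metric \<open>e\<^sup>2\<^sup>\<lambda> |dz|\<^sup>2\<close> the connection is
  \<open>\<nabla>\<^sub>a b = d\<lambda>(a) b + d\<lambda>(b) a - (a \<bullet> b) \<nabla>\<lambda>\<close>.  Here \<open>e\<^sup>\<lambda> = \<sigma>\<close> and \<open>\<nabla>\<lambda> = \<sigma>(z) z\<close>; the vertical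
  factor is flat.
\<close>

lemma christoffel_H2R:
  assumes "norm (fst p) < 1"
  shows "christoffel H2R_metric p a b =
    (sigma (fst p) *\<^sub>R ((fst p \<bullet> fst a) *\<^sub>R fst b + (fst p \<bullet> fst b) *\<^sub>R fst a
        - (fst a \<bullet> fst b) *\<^sub>R fst p), 0)"
proof (rule christoffel_eqI)
  have s: "sigma (fst p) > 0" using assms by (rule sigma_pos)
  have D: "dir_deriv (\<lambda>q. H2R_metric q v w) p u
      = 2 * (sigma (fst p)) ^ 3 * (fst p \<bullet> fst u) * (fst v \<bullet> fst w)" for u v w
  proof (rule dir_deriv_eq)
    have "((\<lambda>q::complex \<times> real. (sigma (fst q))\<^sup>2) has_derivative
        (\<lambda>u. 2 * (sigma (fst p)) ^ 3 * (fst p \<bullet> fst u))) (at p)"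
      using has_derivative_compose[OF has_derivative_fst[OF has_derivative_ident]
          has_derivative_sigma_squared[OF assms]] by simp
    from has_derivative_add_const[OF has_derivative_mult_left[OF this, of "fst v \<bullet> fst w"],
        of "snd v * snd w"]
    show "((\<lambda>q. H2R_metric q v w) has_derivative
      (\<lambda>u. 2 * (sigma (fst p)) ^ 3 * (fst p \<bullet> fst u) * (fst v \<bullet> fst w))) (at p)"
      by (simp add: H2R_metric_def H2_metric_def)
  qed
  show "H2R_metric p (sigma (fst p) *\<^sub>R ((fst p \<bullet> fst a) *\<^sub>R fst b + (fst p \<bullet> fst b) *\<^sub>R fst a
        - (fst a \<bullet> fst b) *\<^sub>R fst p), 0) w = christoffel_first H2R_metric p a b w" for w
    unfolding christoffel_first_def D
    by (simp add: H2R_metric_def H2_metric_def algebra_simps power2_eq_square power3_eq_cube)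
  fix c c' :: "complex \<times> real"
  assume "\<And>w. H2R_metric p c' w = H2R_metric p c w"
  from this[of "c' - c"] have "H2R_metric p (c' - c) (c' - c) = 0"
    by (simp add: H2R_metric_def H2_metric_def algebra_simps)
  then have "fst (c' - c) \<bullet> fst (c' - c) = 0 \<and> snd (c' - c) * snd (c' - c) = 0"
    using s unfolding H2R_metric_def H2_metric_def
    by (smt (verit) inner_ge_zero mult_eq_0_iff mult_nonneg_nonneg zero_le_power2 zero_le_square
        power_eq_0_iff)
  then show "c' = c" by (simp add: prod_eq_iff)
qed

text \<open>
  Conformality makes the differential injective, since a vector in its kernel has length \<open>0\<close>.
\<close>

lemma immersion_onI:
  assumes "smooth_on \<Omega> X" "X ` \<Omega> \<subseteq> H2R" "conformal_on \<Omega> X"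
  shows "immersion_on \<Omega> X"
  unfolding immersion_on_def
proof (intro conjI ballI assms(1,2))
  fix w assume w: "w \<in> \<Omega>"
  have "Ck_on (Suc 0) \<Omega> X" using assms(1) unfolding smooth_on_def by blast
  then have "(X has_derivative dir_deriv X w) (at w)"
    using w by (intro has_derivative_dir_deriv) simp
  then have lin: "linear (dir_deriv X w)" by (rule has_derivative_linear)
  obtain \<mu> where "\<mu> > 0" and \<mu>: "\<And>a b. induced_metric X w a b = \<mu> * (a \<bullet> b)"
    using assms(3) w unfolding conformal_on_def by blast
  have "a = 0" if "dir_deriv X w a = 0" for a
    using \<mu>[of a a] \<open>\<mu> > 0\<close> that by (simp add: induced_metric_def H2R_metric_def H2_metric_def)
  then show "inj (dir_deriv X w)" using linear_injective_0[OF lin] by blast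
qed

text \<open>
  In a conformal parametrization the mean curvature is, up to a factor, the normal component of the
  tension field \<open>\<nabla>\<^sub>u X\<^sub>u + \<nabla>\<^sub>v X\<^sub>v\<close>; it therefore suffices that \<open>X\<close> is harmonic, and no unit normal
  has to be computed.
\<close>

lemma minimal_on_harmonic:
  assumes "conformal_on \<Omega> X" "\<And>w. w \<in> \<Omega> \<Longrightarrow> cov_deriv X w 1 1 + cov_deriv X w \<i> \<i> = 0"
  shows "minimal_on \<Omega> X"
  unfolding minimal_on_def
proof (intro ballI allI impI)
  fix w n assume w: "w \<in> \<Omega>"
  obtain \<mu> where \<mu>: "\<And>a b. induced_metric X w a b = \<mu> * (a \<bullet> b)"
    using assms(1) w unfolding conformal_on_def by blast
  have "second_fundamental_form X w n 1 1 + second_fundamental_form X w n \<i> \<i>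
      = H2R_metric (X w) (cov_deriv X w 1 1 + cov_deriv X w \<i> \<i>) n"
    by (simp add: second_fundamental_form_def H2R_metric_def H2_metric_def algebra_simps)
  also have "\<dots> = 0"
    unfolding assms(2)[OF w] by (simp add: H2R_metric_def H2_metric_def)
  finally show "mean_curvature X w n = 0"
    by (simp add: mean_curvature_def Let_def \<mu> flip: distrib_left)
qed

section \<open>The hyperbolic strip\<close>

definition strip :: "complex set" where
  "strip = {w. \<bar>Re w\<bar> < pi / 2}"

lemma open_strip: "open strip"
  unfolding strip_def by (intro open_Collect_less continuous_intros)

lemma convex_strip: "convex strip"
proof -
  have "strip = {w. Re w < pi / 2} \<inter> {w. Re w > - pi / 2}"
    by (auto simp: strip_def)
  then show ?thesis
    using convex_Int convex_halfspace_Re_lt convex_halfspace_Re_gt by metis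
qed

lemma cos_strip_pos: "w \<in> strip \<Longrightarrow> cos (Re w) > 0"
  by (auto simp: strip_def intro: cos_gt_zero_pi)

lemma cos_half_Re_nonzero:
  assumes "w \<in> strip"
  shows "cos (Re w / 2) \<noteq> 0"
proof -
  have "cos (Re w / 2) > 0"
    using assms by (intro cos_gt_zero_pi) (auto simp: strip_def abs_less_iff)
  then show ?thesis by simp
qed

text \<open>
  With \<open>\<lambda> = - ln (cos u)\<close>, the gradient of \<open>\<lambda>\<close> is \<open>tan u\<close> times the vector \<open>1\<close>, so
  \<open>\<nabla>\<^sub>i i = - tan u\<close> and \<open>\<nabla>\<^sub>1 i = i tan u\<close>.  In the curvature tensor the quadratic terms cancel,
  and what is left is the derivative \<open>- 1 / (cos u)\<^sup>2\<close> of the first of these fields.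
\<close>

lemma gauss_curvature_strip:
  assumes g: "\<And>w a b. w \<in> strip \<Longrightarrow> g w a b = 1 / (cos (Re w))\<^sup>2 * (a \<bullet> b)" and p: "p \<in> strip"
  shows "gauss_curvature g p = - 1"
proof -
  have D: "dir_deriv (\<lambda>q. g q v w) p u = 2 * tan (Re p) / (cos (Re p))\<^sup>2 * Re u * (v \<bullet> w)"
    if "p \<in> strip" for p u v w
  proof (rule dir_deriv_eq_on[OF open_strip that g], assumption)
    show "((\<lambda>q. 1 / (cos (Re q))\<^sup>2 * (v \<bullet> w)) has_derivative
        (\<lambda>u. 2 * tan (Re p) / (cos (Re p))\<^sup>2 * Re u * (v \<bullet> w))) (at p)"
      using cos_strip_pos[OF that]
      by (auto intro!: derivative_eq_intros simp: tan_def divide_simps power2_eq_square)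
  qed
  have \<Gamma>: "christoffel g p u v = tan (Re p) *\<^sub>R (Re u *\<^sub>R v + Re v *\<^sub>R u - (u \<bullet> v) *\<^sub>R 1)"
    if "p \<in> strip" for p u v
  proof (rule christoffel_eqI)
    show "g p (tan (Re p) *\<^sub>R (Re u *\<^sub>R v + Re v *\<^sub>R u - (u \<bullet> v) *\<^sub>R 1)) w
        = christoffel_first g p u v w" for w
      unfolding christoffel_first_def D[OF that] g[OF that]
      by (simp add: inner_complex_def algebra_simps add_divide_distrib diff_divide_distrib)
    fix c c' :: complex
    assume "\<And>w. g p c' w = g p c w"
    then have "(c' - c) \<bullet> (c' - c) = 0"
      using cos_strip_pos[OF that] unfolding g[OF that]
      by (simp add: inner_diff_left)
    then show "c' = c" by simp
  qed
  have c: "cos (Re p) > 0" using cos_strip_pos p by blast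
  have "dir_deriv (\<lambda>q. christoffel g q \<i> \<i>) p 1 = - (of_real (1 / (cos (Re p))\<^sup>2) :: complex)"
  proof -
    have "((\<lambda>q. - complex_of_real (tan (Re q))) has_derivative
        (\<lambda>v. - (of_real (Re v / (cos (Re p))\<^sup>2) :: complex))) (at p)"
      using c by (auto intro!: derivative_eq_intros simp: divide_simps)
    from dir_deriv_eq_on[OF open_strip p _ this, of "\<lambda>q. christoffel g q \<i> \<i>" 1]
    show ?thesis by (simp add: \<Gamma> scaleR_conv_of_real)
  qed
  moreover have "dir_deriv (\<lambda>q. christoffel g q 1 \<i>) p \<i> = 0"
  proof -
    have "((\<lambda>q. complex_of_real (tan (Re q)) * \<i>) has_derivative
        (\<lambda>v. of_real (Re v / (cos (Re p))\<^sup>2) * \<i>)) (at p)"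
      using c by (auto intro!: derivative_eq_intros simp: divide_simps)
    from dir_deriv_eq_on[OF open_strip p _ this, of "\<lambda>q. christoffel g q 1 \<i>" \<i>]
    show ?thesis by (simp add: \<Gamma> scaleR_conv_of_real)
  qed
  ultimately have "riemann g p 1 \<i> \<i> = - of_real (1 / (cos (Re p))\<^sup>2)"
    by (simp add: riemann_def \<Gamma>[OF p] scaleR_conv_of_real)
  then show ?thesis
    using c by (simp add: gauss_curvature_def g[OF p] power2_eq_square)
qed

section \<open>The horizontal slice\<close>

definition slice :: "complex \<Rightarrow> complex \<times> real" where
  "slice w = (tan (w / 2), 0)"

text \<open>
  This identity gives both that \<open>tan (w/2)\<close> has no pole in the strip and that it maps the strip
  into the unit disc.
\<close>

lemma norm_cos_sin_half:
  "(norm (cos (w / 2)))\<^sup>2 - (norm (sin (w / 2)))\<^sup>2 = cos (Re w)"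
proof -
  have "cos (Re w) = 2 * (cos (Re w / 2))\<^sup>2 - 1"
    using cos_double_cos[of "Re w / 2"] by simp
  moreover have "exp (Im w) = (exp (Im w / 2))\<^sup>2"
    using exp_double[of "Im w / 2"] by simp
  ultimately show ?thesis
    unfolding norm_cos_squared norm_sin_squared
    by (simp add: power2_diff power_inverse add_divide_distrib diff_divide_distrib)
qed

lemma cos_half_nonzero: "w \<in> strip \<Longrightarrow> cos (w / 2) \<noteq> 0"
proof
  assume "w \<in> strip" "cos (w / 2) = 0"
  then show False
    using norm_cos_sin_half[of w] cos_strip_pos[of w]
    by (smt (verit) norm_zero power_zero_numeral zero_le_power2)
qed

lemma norm_tan_half:
  assumes "w \<in> strip"
  shows "1 - (norm (tan (w / 2)))\<^sup>2 = cos (Re w) / (norm (cos (w / 2)))\<^sup>2"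
  using cos_half_nonzero[OF assms]
  by (simp add: tan_def norm_divide power_divide diff_divide_distrib flip: norm_cos_sin_half)

lemma norm_tan_half_less: "w \<in> strip \<Longrightarrow> norm (tan (w / 2)) < 1"
  using norm_tan_half[of w] cos_strip_pos[of w] cos_half_nonzero[of w]
  by (smt (verit) divide_pos_pos norm_ge_zero one_le_power zero_less_norm_iff zero_less_power)

text \<open>
  Since \<open>T = tan (w/2)\<close> satisfies \<open>T' = (1 + T\<^sup>2) / 2\<close>, the polynomials in \<open>T\<close> are closed under
  differentiation.
\<close>

lemma poly_tan_has_derivative:
  assumes "w \<in> strip"
  shows "((\<lambda>w. poly P (tan (w / 2))) has_derivative
    (\<lambda>v. poly (smult v (pderiv P * [:1 / 2, 0, 1 / 2:])) (tan (w / 2)))) (at w)"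
proof -
  have "((\<lambda>w. tan (w / 2)) has_field_derivative inverse ((cos (w / 2))\<^sup>2) * (1 / 2)) (at w)"
    using cos_half_nonzero[OF assms] by (auto intro!: derivative_eq_intros)
  moreover have "inverse ((cos (w / 2))\<^sup>2) = 1 + (tan (w / 2))\<^sup>2"
    using cos_half_nonzero[OF assms] sin_cos_squared_add[of "w / 2"]
    by (simp add: tan_def field_simps)
  ultimately have "((\<lambda>w. tan (w / 2)) has_field_derivative (1 + (tan (w / 2))\<^sup>2) / 2) (at w)"
    by simp
  from DERIV_chain2[OF poly_DERIV this, of P] show ?thesis
    unfolding has_field_derivative_def
    by (rule has_derivative_eq_rhs) (auto simp: fun_eq_iff field_simps power2_eq_square)
qed

lemma slice_dir_deriv:
  assumes "w \<in> strip"
  shows "dir_deriv slice w a = (a * ((1 + (tan (w / 2))\<^sup>2) / 2), 0)"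
proof (rule dir_deriv_eq)
  show "(slice has_derivative (\<lambda>a. (a * ((1 + (tan (w / 2))\<^sup>2) / 2), 0))) (at w)"
    unfolding slice_def[abs_def]
    using has_derivative_Pair[OF poly_tan_has_derivative[OF assms, of "[:0, 1:]"]
        has_derivative_const[of 0]]
    by (simp add: field_simps power2_eq_square pderiv_pCons)
qed

lemma slice_dir_deriv2:
  assumes "w \<in> strip"
  shows "dir_deriv (\<lambda>q. dir_deriv slice q b) w a
    = (a * b * tan (w / 2) * (1 + (tan (w / 2))\<^sup>2) / 2, 0)"
proof (rule dir_deriv_eq_on[OF open_strip assms slice_dir_deriv], assumption)
  show "((\<lambda>q. (b * ((1 + (tan (q / 2))\<^sup>2) / 2), 0::real)) has_derivative
     (\<lambda>a. (a * b * tan (w / 2) * (1 + (tan (w / 2))\<^sup>2) / 2, 0))) (at w)"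
    using has_derivative_Pair[OF poly_tan_has_derivative[OF assms, of "[:b / 2, 0, b / 2:]"]
        has_derivative_const[of 0]]
    by (simp add: field_simps power2_eq_square pderiv_pCons)
qed

lemma smooth_on_slice: "smooth_on strip slice"
  unfolding smooth_on_def
proof
  fix k
  have "Ck_on k strip (\<lambda>w. poly [:0, 1:] (tan (w / 2)))"
    by (rule Ck_on_closed_family[OF open_strip, where \<Phi> = "\<lambda>P w. poly P (tan (w / 2))",
          OF poly_tan_has_derivative])
  from Ck_on_linear_compose[OF open_strip _ this, of "\<lambda>z. (z, 0 :: real)"]
  show "Ck_on k strip slice"
    by (simp add: slice_def[abs_def] bounded_linear_Pair bounded_linear_ident)
qed

lemma inner_mult_complex: "(a * z) \<bullet> (b * z) = (norm z)\<^sup>2 * (a \<bullet> b)" for a b z :: complex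
  by (simp add: inner_complex_def cmod_power2) (simp add: power2_eq_square algebra_simps)

lemma slice_metric:
  assumes "w \<in> strip"
  shows "induced_metric slice w a b = 1 / (cos (Re w))\<^sup>2 * (a \<bullet> b)"
proof -
  define c where "c = cos (w / 2)"
  define s where "s = sin (w / 2)"
  have c: "c \<noteq> 0" using cos_half_nonzero[OF assms] by (simp add: c_def)
  have "1 + (tan (w / 2))\<^sup>2 = 1 / c\<^sup>2"
    using c sin_cos_squared_add[of "w / 2"] by (simp add: tan_def c_def field_simps)
  then have 1: "norm ((1 + (tan (w / 2))\<^sup>2) / 2) = 1 / (2 * (norm c)\<^sup>2)"
    by (simp add: norm_divide norm_power)
  have 2: "sigma (tan (w / 2)) = 2 * (norm c)\<^sup>2 / cos (Re w)"
    by (simp add: sigma_def norm_tan_half[OF assms] c_def)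
  show ?thesis
    using c cos_strip_pos[OF assms]
    unfolding induced_metric_def slice_dir_deriv[OF assms] H2R_metric_def H2_metric_def fst_conv
      inner_mult_complex slice_def 1 2
    by (simp add: field_simps)
qed

text \<open>
  A holomorphic map between surfaces is harmonic for every conformal metric on the target: its
  differential commutes with multiplication by \<open>\<i>\<close>, and both the flat Laplacian and the trace of the
  connection term cancel.
\<close>

lemma slice_harmonic:
  assumes "w \<in> strip"
  shows "cov_deriv slice w 1 1 + cov_deriv slice w \<i> \<i> = 0"
proof -
  define T where "T = tan (w / 2)"
  define d where "d = (1 + T\<^sup>2) / 2"
  have "sigma T *\<^sub>R ((T \<bullet> d) *\<^sub>R d + (T \<bullet> d) *\<^sub>R d - (d \<bullet> d) *\<^sub>R T)
      + sigma T *\<^sub>R ((T \<bullet> (\<i> * d)) *\<^sub>R (\<i> * d) + (T \<bullet> (\<i> * d)) *\<^sub>R (\<i> * d)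
        - ((\<i> * d) \<bullet> (\<i> * d)) *\<^sub>R T) = 0"
    by (simp add: complex_eq_iff inner_complex_def algebra_simps)
  moreover have "dir_deriv slice w a = (a * d, 0)"
      "dir_deriv (\<lambda>q. dir_deriv slice q b) w a = (a * b * T * d, 0)" for a b
    using slice_dir_deriv[OF assms, of a] slice_dir_deriv2[OF assms, of b a]
    by (simp_all add: T_def d_def)
  moreover have "norm (fst (slice w)) < 1" "fst (slice w) = T"
    using norm_tan_half_less[OF assms] by (simp_all add: slice_def T_def)
  ultimately show ?thesis
    by (simp add: cov_deriv_def christoffel_H2R zero_prod_def)
qed

text \<open>
  The second Wirtinger factor is the conjugate of the antiholomorphic derivative of \<open>h\<close>, which
  vanishes for holomorphic \<open>h\<close>.
\<close>

lemma slice_hopf: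
  assumes "w \<in> strip"
  shows "hopf (fst \<circ> slice) w = 0"
proof -
  have "((\<lambda>q. cnj ((fst \<circ> slice) q)) has_derivative
      (\<lambda>a. cnj (a * ((1 + (tan (w / 2))\<^sup>2) / 2)))) (at w)"
    using has_derivative_cnj[OF poly_tan_has_derivative[OF assms, of "[:0, 1:]"]]
    by (simp add: slice_def field_simps power2_eq_square pderiv_pCons)
  from dir_deriv_eq[OF this] have "wirtinger (\<lambda>q. cnj ((fst \<circ> slice) q)) w = 0"
    unfolding wirtinger_def by (simp only:) (simp add: add_divide_distrib diff_divide_distrib)
  then show ?thesis by (simp only: hopf_def mult_zero_right)
qed

section \<open>The helicoid\<close>

definition helicoid :: "complex \<Rightarrow> complex \<times> real" where
  "helicoid w = (of_real (tan (Re w / 2)) * cis (Im w), Im w)"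

text \<open>
  For \<open>T = tan (u/2)\<close>, differentiation in \<open>u\<close> acts on the coefficient \<open>P(T)\<close> of \<open>e\<^sup>i\<^sup>v\<close> as
  \<open>P \<mapsto> P' (1 + T\<^sup>2) / 2\<close>, and differentiation in \<open>v\<close> multiplies it by \<open>\<i>\<close>.  The coefficients are
  complex so that the family is closed under both.
\<close>

lemma poly_tan_cis_has_derivative:
  assumes "w \<in> strip"
  shows "((\<lambda>w. poly P (complex_of_real (tan (Re w / 2))) * cis (Im w)) has_derivative
    (\<lambda>v. poly (smult (of_real (Re v)) (pderiv P * [:1 / 2, 0, 1 / 2:]) + smult (\<i> * of_real (Im v)) P)
       (complex_of_real (tan (Re w / 2))) * cis (Im w))) (at w)"
proof -
  have c: "cos (Re w / 2) \<noteq> 0"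
    using assms by (rule cos_half_Re_nonzero)
  then have "inverse ((cos (Re w / 2))\<^sup>2) = 1 + (tan (Re w / 2))\<^sup>2"
    using sin_cos_squared_add[of "Re w / 2"] by (simp add: tan_def field_simps)
  then have "(tan has_field_derivative 1 + (tan (Re w / 2))\<^sup>2) (at (Re w / 2))"
    using DERIV_tan[OF c] by simp
  moreover have "((\<lambda>w. Re w / 2) has_derivative (\<lambda>v. Re v / 2)) (at w)"
    by (auto intro!: derivative_eq_intros)
  ultimately have "((\<lambda>w. tan (Re w / 2)) has_derivative
      (\<lambda>v. (1 + (tan (Re w / 2))\<^sup>2) * (Re v / 2))) (at w)"
    unfolding has_field_derivative_def by (rule has_derivative_compose[rotated])
  then have "((\<lambda>w. tan (Re w / 2)) has_derivative
      (\<lambda>v. Re v * (1 + (tan (Re w / 2))\<^sup>2) / 2)) (at w)"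
    by (simp add: mult.commute)
  note has_derivative_of_real[OF this]
  from has_derivative_compose[OF this, of "poly P"]
  have "((\<lambda>w. poly P (complex_of_real (tan (Re w / 2)))) has_derivative
      (\<lambda>v. poly (pderiv P) (of_real (tan (Re w / 2)))
        * of_real (Re v * (1 + (tan (Re w / 2))\<^sup>2) / 2))) (at w)"
    using poly_DERIV[of P "of_real (tan (Re w / 2))"] unfolding has_field_derivative_def by blast
  moreover have "((\<lambda>w. cis (Im w)) has_derivative (\<lambda>v. Im v *\<^sub>R (\<i> * cis (Im w)))) (at w)"
    by (auto intro!: derivative_eq_intros)
  ultimately have "((\<lambda>w. poly P (complex_of_real (tan (Re w / 2))) * cis (Im w)) has_derivative
      (\<lambda>v. poly P (of_real (tan (Re w / 2))) * (Im v *\<^sub>R (\<i> * cis (Im w)))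
        + poly (pderiv P) (of_real (tan (Re w / 2)))
          * of_real (Re v * (1 + (tan (Re w / 2))\<^sup>2) / 2) * cis (Im w))) (at w)"
    by (rule has_derivative_mult)
  then show ?thesis
    by (rule has_derivative_eq_rhs)
      (simp add: fun_eq_iff algebra_simps power2_eq_square scaleR_conv_of_real add_divide_distrib)
qed

lemma helicoid_dir_deriv:
  assumes "w \<in> strip"
  shows "dir_deriv helicoid w a = ((of_real (Re a * (1 + (tan (Re w / 2))\<^sup>2) / 2)
      + \<i> * of_real (Im a * tan (Re w / 2))) * cis (Im w), Im a)"
proof (rule dir_deriv_eq)
  show "(helicoid has_derivative (\<lambda>a. ((of_real (Re a * (1 + (tan (Re w / 2))\<^sup>2) / 2)
      + \<i> * of_real (Im a * tan (Re w / 2))) * cis (Im w), Im a))) (at w)"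
    unfolding helicoid_def[abs_def]
    using has_derivative_Pair[OF poly_tan_cis_has_derivative[OF assms, of "[:0, 1:]"]
        bounded_linear_imp_has_derivative[OF bounded_linear_Im]]
    by (simp add: field_simps power2_eq_square pderiv_pCons)
qed

lemma helicoid_dir_deriv2:
  assumes "w \<in> strip"
  shows "dir_deriv (\<lambda>q. dir_deriv helicoid q 1) w 1
      = (of_real (tan (Re w / 2) * (1 + (tan (Re w / 2))\<^sup>2) / 2) * cis (Im w), 0)"
    and "dir_deriv (\<lambda>q. dir_deriv helicoid q \<i>) w \<i>
      = (- of_real (tan (Re w / 2)) * cis (Im w), 0)"
proof -
  \<comment> \<open>The polynomial \<open>P\<close> in \<open>T\<close> is the coefficient of \<open>e\<^sup>i\<^sup>v\<close> in the first derivative in the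
    direction \<open>b\<close>.\<close>
  have D: "dir_deriv (\<lambda>q. dir_deriv helicoid q b) w a
      = (poly (smult (of_real (Re a)) (pderiv P * [:1 / 2, 0, 1 / 2:]) + smult (\<i> * of_real (Im a)) P)
       (complex_of_real (tan (Re w / 2))) * cis (Im w), 0)"
    if P: "P = [:of_real (Re b / 2), \<i> * of_real (Im b), of_real (Re b / 2):]" for a b P
  proof (rule dir_deriv_eq_on[OF open_strip assms])
    show "((\<lambda>q. (poly P (complex_of_real (tan (Re q / 2))) * cis (Im q), Im b)) has_derivative
      (\<lambda>a. (poly (smult (of_real (Re a)) (pderiv P * [:1 / 2, 0, 1 / 2:])
          + smult (\<i> * of_real (Im a)) P) (complex_of_real (tan (Re w / 2))) * cis (Im w), 0))) (at w)"
      by (intro has_derivative_Pair poly_tan_cis_has_derivative[OF assms] has_derivative_const)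
  qed (simp add: helicoid_dir_deriv P field_simps power2_eq_square)
  show "dir_deriv (\<lambda>q. dir_deriv helicoid q 1) w 1
      = (of_real (tan (Re w / 2) * (1 + (tan (Re w / 2))\<^sup>2) / 2) * cis (Im w), 0)"
    "dir_deriv (\<lambda>q. dir_deriv helicoid q \<i>) w \<i>
      = (- of_real (tan (Re w / 2)) * cis (Im w), 0)"
    by (simp_all add: D pderiv_pCons field_simps power2_eq_square)
qed

lemma tan_half_strip:
  assumes "w \<in> strip"
  shows "(tan (Re w / 2))\<^sup>2 < 1"
    and "cos (Re w) = (1 - (tan (Re w / 2))\<^sup>2) / (1 + (tan (Re w / 2))\<^sup>2)"
proof -
  have "cos (Re w / 2) \<noteq> 0"
    using assms by (rule cos_half_Re_nonzero)
  from cos_tan_half[OF this]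
  show *: "cos (Re w) = (1 - (tan (Re w / 2))\<^sup>2) / (1 + (tan (Re w / 2))\<^sup>2)"
    by simp
  show "(tan (Re w / 2))\<^sup>2 < 1"
    using cos_strip_pos[OF assms] unfolding *
    by (smt (verit) divide_nonpos_nonneg zero_le_power2)
qed

lemma norm_helicoid: "norm (fst (helicoid w)) = \<bar>tan (Re w / 2)\<bar>"
  by (simp add: helicoid_def norm_mult)

lemma sigma_helicoid: "sigma (fst (helicoid w)) = 2 / (1 - (tan (Re w / 2))\<^sup>2)"
  by (simp add: sigma_def norm_helicoid)

lemma norm_helicoid_less: "w \<in> strip \<Longrightarrow> norm (fst (helicoid w)) < 1"
  unfolding norm_helicoid using tan_half_strip(1) abs_square_less_1 by blast

lemma inner_mult_cis: "(x * cis t) \<bullet> (y * cis t) = x \<bullet> y"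
  by (simp add: inner_mult_complex)

lemma helicoid_metric:
  assumes "w \<in> strip"
  shows "induced_metric helicoid w a b = 1 / (cos (Re w))\<^sup>2 * (a \<bullet> b)"
proof -
  define T where "T = tan (Re w / 2)"
  have T: "T\<^sup>2 < 1" "cos (Re w) = (1 - T\<^sup>2) / (1 + T\<^sup>2)"
    using tan_half_strip[OF assms] by (simp_all add: T_def)
  have "induced_metric helicoid w a b
    = (2 / (1 - T\<^sup>2))\<^sup>2 * (((1 + T\<^sup>2) / 2)\<^sup>2 * (Re a * Re b) + T\<^sup>2 * (Im a * Im b)) + Im a * Im b"
    unfolding induced_metric_def H2R_metric_def H2_metric_def helicoid_dir_deriv[OF assms]
      fst_conv snd_conv inner_mult_cis sigma_helicoid T_def[symmetric]
    by (simp add: inner_complex_def power2_eq_square)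
  also have "\<dots> = ((1 + T\<^sup>2) / (1 - T\<^sup>2))\<^sup>2 * (a \<bullet> b)"
    using T(1) by (simp add: inner_complex_def divide_simps) (simp add: algebra_simps power2_eq_square)
  finally show ?thesis using T by (simp add: power_divide)
qed

text \<open>
  By rotational symmetry the tension field is a real multiple of \<open>e\<^sup>i\<^sup>v\<close>, and harmonicity becomes the
  equation \<open>T'' - T + \<sigma> (T T'\<^sup>2 - T\<^sup>3) = 0\<close> for \<open>T = tan (u/2)\<close>.  It holds because
  \<open>T'' - T = - T (1 - T\<^sup>2) / 2\<close> and \<open>T'\<^sup>2 - T\<^sup>2 = (1 - T\<^sup>2)\<^sup>2 / 4\<close>, with \<open>\<sigma> = 2 / (1 - T\<^sup>2)\<close>.
\<close>

lemma helicoid_harmonic: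
  assumes "w \<in> strip"
  shows "cov_deriv helicoid w 1 1 + cov_deriv helicoid w \<i> \<i> = 0"
proof -
  define T where "T = tan (Re w / 2)"
  define e where "e = cis (Im w)"
  define s where "s = 2 / (1 - T\<^sup>2)"
  have "T\<^sup>2 < 1" using tan_half_strip(1)[OF assms] by (simp add: T_def)
  have h: "fst (helicoid w) = of_real T * e" by (simp add: helicoid_def T_def e_def)
  have s: "sigma (of_real T * e) = s"
    using sigma_helicoid[of w] unfolding h s_def T_def .
  have "cov_deriv helicoid w 1 1 + cov_deriv helicoid w \<i> \<i>
     = (of_real (T * (1 + T\<^sup>2) / 2 - T + s * (T * ((1 + T\<^sup>2) / 2)\<^sup>2 - T ^ 3)) * e, 0)"
    unfolding cov_deriv_def helicoid_dir_deriv[OF assms] helicoid_dir_deriv2[OF assms]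
      christoffel_H2R[OF norm_helicoid_less[OF assms]] h s T_def[symmetric] e_def[symmetric] fst_conv
    unfolding e_def inner_mult_cis
    by (simp add: inner_complex_def scaleR_conv_of_real field_simps power2_eq_square power3_eq_cube)
  also have "T * (1 + T\<^sup>2) / 2 - T + s * (T * ((1 + T\<^sup>2) / 2)\<^sup>2 - T ^ 3) = 0"
    using \<open>T\<^sup>2 < 1\<close> unfolding s_def
    by (simp add: divide_simps) (simp add: algebra_simps power2_eq_square power3_eq_cube)
  finally show ?thesis by (simp add: zero_prod_def)
qed

lemma hopf_helicoid_0: "hopf (fst \<circ> helicoid) 0 = 1 / 4"
proof -
  have 0: "0 \<in> strip" by (simp add: strip_def)
  have *: "(fst \<circ> helicoid has_derivative (\<lambda>a. of_real (Re a) / 2)) (at 0)"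
    using poly_tan_cis_has_derivative[OF 0, of "[:0, 1:]"]
    by (simp add: pderiv_pCons comp_def helicoid_def)
  show ?thesis
    unfolding hopf_def wirtinger_def dir_deriv_eq[OF *] dir_deriv_eq[OF has_derivative_cnj[OF *]]
    by (simp add: helicoid_def sigma_def)
qed

lemma smooth_on_helicoid: "smooth_on strip helicoid"
  unfolding smooth_on_def
proof
  fix k
  have "Ck_on k strip (\<lambda>w. poly [:0, 1:] (complex_of_real (tan (Re w / 2))) * cis (Im w))"
    by (rule Ck_on_closed_family[OF open_strip,
          where \<Phi> = "\<lambda>P w. poly P (complex_of_real (tan (Re w / 2))) * cis (Im w)",
          OF poly_tan_cis_has_derivative])
  from Ck_on_add[OF open_strip Ck_on_linear_compose[OF open_strip _ this, of "\<lambda>z. (z, 0)"]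
      Ck_on_linear[OF open_strip, of "\<lambda>w. (0, Im w)"]]
  show "Ck_on k strip helicoid"
    by (simp add: helicoid_def[abs_def] bounded_linear_Pair bounded_linear_ident
        bounded_linear_Im bounded_linear_zero)
qed

section \<open>Two isometric minimal surfaces that are not associate\<close>

lemma conformal_minimal_immersion_strip:
  assumes "smooth_on strip X" "X ` strip \<subseteq> H2R"
    and "\<And>w a b. w \<in> strip \<Longrightarrow> induced_metric X w a b = 1 / (cos (Re w))\<^sup>2 * (a \<bullet> b)"
    and "\<And>w. w \<in> strip \<Longrightarrow> cov_deriv X w 1 1 + cov_deriv X w \<i> \<i> = 0"
  shows "conformal_minimal_immersion strip X"
proof -
  have "conformal_on strip X"
    unfolding conformal_on_def
  proof
    fix w assume "w \<in> strip"
    then show "\<exists>\<mu>>0. \<forall>a b. induced_metric X w a b = \<mu> * (a \<bullet> b)"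
      using assms(3) cos_strip_pos by (intro exI[of _ "1 / (cos (Re w))\<^sup>2"]) fastforce
  qed
  with assms show ?thesis
    by (simp add: conformal_minimal_immersion_def immersion_onI minimal_on_harmonic)
qed

theorem mainTheorem6:
  "\<exists>(\<Omega> :: complex set) (X :: complex \<Rightarrow> complex \<times> real) (Y :: complex \<Rightarrow> complex \<times> real).
     open \<Omega> \<and> connected \<Omega> \<and> \<Omega> \<noteq> {} \<and> simply_connected \<Omega> \<and>
     conformal_minimal_immersion \<Omega> X \<and> conformal_minimal_immersion \<Omega> Y \<and>
     isometric_on \<Omega> X Y \<and>
     (\<forall>w\<in>\<Omega>. gauss_curvature (induced_metric X) w = - 1) \<and>
     \<not> associate_on \<Omega> X Y"
proof (intro exI conjI)
  have 0: "0 \<in> strip" by (simp add: strip_def)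
  show "open strip" by (rule open_strip)
  show "connected strip" using convex_strip by (rule convex_connected)
  show "strip \<noteq> {}" using 0 by blast
  show "simply_connected strip" using convex_strip by (rule convex_imp_simply_connected)
  have "slice ` strip \<subseteq> H2R"
    using norm_tan_half_less by (auto simp: H2R_def slice_def)
  then show "conformal_minimal_immersion strip slice"
    by (rule conformal_minimal_immersion_strip[OF smooth_on_slice _ slice_metric slice_harmonic])
  have "helicoid ` strip \<subseteq> H2R"
    using norm_helicoid_less unfolding H2R_def image_subset_iff mem_Times_iff by simp
  then show "conformal_minimal_immersion strip helicoid"
    by (rule conformal_minimal_immersion_strip[OF smooth_on_helicoid _ helicoid_metric
          helicoid_harmonic])
  show "isometric_on strip slice helicoid"
    by (simp add: isometric_on_def slice_metric helicoid_metric)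
  show "\<forall>w\<in>strip. gauss_curvature (induced_metric slice) w = - 1"
    using gauss_curvature_strip slice_metric by blast
  show "\<not> associate_on strip slice helicoid"
  proof
    assume "associate_on strip slice helicoid"
    then have "hopf (fst \<circ> helicoid) 0 = 0"
      using 0 slice_hopf[OF 0] by (auto simp: associate_on_def)
    then show False by (simp add: hopf_helicoid_0)
  qed
qed

end
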